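(* Let $0<\lambda\le\frac{\pi}{2}$, $0\le\hat p\le\lambda$ and $p=\hat p/\lambda$ (so that $0\le p\le1$). Suppose that $f(z)=z+\sum_{n=2}^{\infty}a_nz^n$ is in the class $\mathcal{K}_{\lambda e}(\hat p)$. Then the following sharp inequalities hold: $$|a_3-a_2|\le\frac1{12}\lambda\left[2+6p-(3\lambda+2)p^2\right],$$ and $$|a_4-a_3|\le\begin{cases}\Theta_1(\lambda,p), & 0<\lambda<\frac45,\\[2pt] \Theta_2(\lambda,p), & \frac45\le\lambda\le\frac{\pi}{2},\end{cases}$$ where $$\Theta_1(\lambda,p)=\frac1{144}\lambda\left[(-17\lambda^2+30\lambda-12)p^3+(36\lambda-24)p^2+(12-30\lambda)p+24\right],$$ $$\Theta_2(\lambda,p)=\begin{cases}\frac1{576}\lambda\left[7\lambda^2p^3+(75\lambda^2+24\lambda-48)p^2+(48-120\lambda)p+96\right], & 0\le p\le\frac{8}{4+5\lambda},\\[4pt] \frac1{144}\lambda\left[(-17\lambda^2-30\lambda-12)p^3+(36\lambda+24)p^2+(30\lambda+12)p-24\right], & \frac{8}{4+5\lambda}<p\le1.\end{cases}$$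
   Context: Let $\mathbb{D}=\{z\in\mathbb{C}:|z|<1\}$ and let $\mathcal{A}$ be the class of functions $f$ analytic in $\mathbb{D}$ of the form $f(z)=z+\sum_{n=2}^{\infty}a_nz^n$. For $g,h$ analytic in $\mathbb{D}$, $g\prec h$ ($g$ is subordinate to $h$) means that there is a Schwarz function $\omega$, i.e. $\omega$ analytic in $\mathbb{D}$ with $\omega(0)=0$ and $|\omega(z)|<1$ for $z\in\mathbb{D}$, such that $g(z)=h(\omega(z))$ for $z\in\mathbb{D}$. For a constant $\lambda$ with $0<\lambda\le\frac{\pi}{2}$, $\mathcal{K}_{\lambda e}$ is the class of $f\in\mathcal{A}$ with $1+\frac{zf''(z)}{f'(z)}\prec e^{\lambda z}$ in $\mathbb{D}$. For a real number $\hat p$ with $-\lambda\le\hat p\le\lambda$, $\mathcal{K}_{\lambda e}(\hat p)=\{f\in\mathcal{K}_{\lambda e}: f''(0)=\hat p\}$. An inequality is sharp if, for each admissible value of the parameters $\lambda,\hat p$, its right-hand side cannot be replaced by a smaller number. *)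

theory Defs
  imports "HOL-Complex_Analysis.Complex_Analysis"
begin

abbreviation unit_disc :: "complex set" where
  "unit_disc \<equiv> ball 0 1"

abbreviation taylor_coeff :: "(complex \<Rightarrow> complex) \<Rightarrow> nat \<Rightarrow> complex" where
  "taylor_coeff f n \<equiv> fps_nth (fps_expansion f 0) n"

definition schwarz_function :: "(complex \<Rightarrow> complex) \<Rightarrow> bool" where
  "schwarz_function \<omega> \<longleftrightarrow>
     \<omega> analytic_on unit_disc \<and> \<omega> 0 = 0 \<and> (\<forall>z\<in>unit_disc. cmod (\<omega> z) < 1)"

definition subordinate ::
  "(complex \<Rightarrow> complex) \<Rightarrow> (complex \<Rightarrow> complex) \<Rightarrow> bool" (infix "\<prec>\<^sub>s" 50) where
  "g \<prec>\<^sub>s h \<longleftrightarrow> g analytic_on unit_disc \<and> h analytic_on unit_disc \<and>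
     (\<exists>\<omega>. schwarz_function \<omega> \<and> (\<forall>z\<in>unit_disc. g z = h (\<omega> z)))"

definition normalized_analytic :: "(complex \<Rightarrow> complex) set" where
  "normalized_analytic = {f. f analytic_on unit_disc \<and>
     (\<forall>z\<in>unit_disc. (\<lambda>n. taylor_coeff f (n + 2) * z ^ (n + 2)) sums (f z - z))}"

(* The quotient in the subordination must be defined on the whole disc. Since x / 0 = 0 in HOL,
   the condition that f' has no zeros there is stated explicitly. *)
definition convex_exp :: "real \<Rightarrow> (complex \<Rightarrow> complex) set" where
  "convex_exp lam = {f \<in> normalized_analytic.
     (\<forall>z\<in>unit_disc. deriv f z \<noteq> 0) \<and>
     (\<lambda>z. 1 + z * deriv (deriv f) z / deriv f z) \<prec>\<^sub>s (\<lambda>z. exp (complex_of_real lam * z))}"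

definition convex_exp_fixed :: "real \<Rightarrow> real \<Rightarrow> (complex \<Rightarrow> complex) set" where
  "convex_exp_fixed lam p_hat = {f \<in> convex_exp lam. deriv (deriv f) 0 = of_real p_hat}"

definition sharp_upper_bound :: "'a set \<Rightarrow> ('a \<Rightarrow> real) \<Rightarrow> real \<Rightarrow> bool" where
  "sharp_upper_bound S F B \<longleftrightarrow>
     (\<forall>f\<in>S. F f \<le> B) \<and> (\<forall>M<B. \<not> (\<forall>f\<in>S. F f \<le> M))"

definition Theta1 :: "real \<Rightarrow> real \<Rightarrow> real" where
  "Theta1 lam p = 1 / 144 * lam *
     ((- 17 * lam^2 + 30 * lam - 12) * p^3 + (36 * lam - 24) * p^2 + (12 - 30 * lam) * p + 24)"

definition Theta2 :: "real \<Rightarrow> real \<Rightarrow> real" where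
  "Theta2 lam p =
     (if p \<le> 8 / (4 + 5 * lam)
      then 1 / 576 * lam *
        (7 * lam^2 * p^3 + (75 * lam^2 + 24 * lam - 48) * p^2 + (48 - 120 * lam) * p + 96)
      else 1 / 144 * lam *
        ((- 17 * lam^2 - 30 * lam - 12) * p^3 + (36 * lam + 24) * p^2 + (30 * lam + 12) * p - 24))"

end

theory Submission
  imports Defs
begin

text \<open>
  Write the Schwarz function of the subordination as \<open>\<omega> z = z * \<phi> z\<close>, so that \<open>\<phi>\<close> maps the
  disc into the closed disc. Comparing Taylor coefficients in
  \<open>z * f'' = (exp (lam * \<omega>) - 1) * f'\<close> gives \<open>a\<^sub>2\<close>, \<open>a\<^sub>3\<close>, \<open>a\<^sub>4\<close> as polynomials in
  the first three coefficients \<open>c\<^sub>0\<close>, \<open>c\<^sub>1\<close>, \<open>c\<^sub>2\<close> of \<open>\<phi>\<close>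
  (\<open>convex_exp_coefficients\<close>), and prescribing \<open>f'' 0\<close> amounts to prescribing \<open>c\<^sub>0 = p\<close>.

  Two steps of the Schur algorithm describe all possible \<open>c\<^sub>1\<close> and \<open>c\<^sub>2\<close>: they are exactly
  \<open>c\<^sub>1 = (1 - p\<^sup>2) * x\<close> and \<open>c\<^sub>2 = (1 - p\<^sup>2) * ((1 - \<bar>x\<bar>\<^sup>2) * y - p * x\<^sup>2)\<close> with
  \<open>x\<close> and \<open>y\<close> in the closed unit disc (\<open>schur_coefficients\<close>, \<open>schur_function_exists\<close>). Every such
  \<open>\<phi>\<close> comes from a member of the class, because the differential equation for \<open>f\<close> can be solved by
  taking primitives on the disc (\<open>convex_exp_from_schwarz_function\<close>). Hence both suprema are maxima
  of explicit expressions over pairs \<open>(x, y)\<close>.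

  The first expression is affine in \<open>x\<close> and is extremal at \<open>x = -1\<close>. For the second, up to the factor
  \<open>lam / 144\<close>, the triangle inequality leaves the real function
  \<open>(1 - p\<^sup>2) * (12 - 12 * (1 - p) * r\<^sup>2 + \<bar>b\<bar> * r) + d\<close> of \<open>r = \<bar>x\<bar>\<close>, where
  \<open>b = 24 - 30 * lam * p\<close> and \<open>d = lam * p\<^sup>2 * (36 - 17 * lam * p) \<ge> 0\<close>. The bound is attained
  since for \<open>y = -1\<close> and real \<open>x\<close> with the sign of \<open>b\<close> all the terms have the same sign.
  For \<open>p < 1\<close> the vertex of this concave quadratic is at \<open>\<bar>b\<bar> / (24 * (1 - p))\<close>. The cases of the result
  record whether the vertex lies in the unit interval, and otherwise which sign \<open>b\<close> has.
\<close>

section \<open>Taylor coefficients at the origin\<close>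

lemma disc_has_fps_expansion:
  assumes "f holomorphic_on unit_disc"
  shows "f has_fps_expansion fps_expansion f 0"
  using assms by (intro has_fps_expansion_fps_expansion[of unit_disc]) auto

lemma fps_eq_if_eq_on_disc:
  assumes "f has_fps_expansion F" "g has_fps_expansion G"
    and "\<And>z. z \<in> unit_disc \<Longrightarrow> f z = g z"
  shows "F = G"
proof -
  have "eventually (\<lambda>z. z \<in> unit_disc) (nhds (0::complex))"
    by (intro eventually_nhds_in_open) auto
  then have "eventually (\<lambda>z. f z = g z) (nhds 0)"
    by eventually_elim (use assms(3) in auto)
  then have "g has_fps_expansion F"
    using assms(1) has_fps_expansion_cong by blast
  then show ?thesis
    using assms(2) fps_expansion_unique_complex by blast
qed

lemma taylor_coeff_0: "taylor_coeff f 0 = f 0"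
  by (simp add: fps_expansion_def)

lemma taylor_coeff_1: "taylor_coeff f 1 = deriv f 0"
  by (simp add: fps_expansion_def)

lemma taylor_coeff_2: "taylor_coeff f 2 = deriv (deriv f) 0 / 2"
  by (simp add: fps_expansion_def numeral_2_eq_2)

lemma analytic_on_unit_disc_iff: "f analytic_on unit_disc \<longleftrightarrow> f holomorphic_on unit_disc"
  by (simp add: analytic_on_open)

text \<open>
  The defining series, which starts at the second power, equals \<open>f z - z\<close> on the whole disc only
  if the affine part of the Taylor series of \<open>f\<close> is the identity.
\<close>
lemma normalized_analytic_iff:
  "f \<in> normalized_analytic \<longleftrightarrow> f holomorphic_on unit_disc \<and> f 0 = 0 \<and> deriv f 0 = 1"
proof (cases "f holomorphic_on unit_disc")
  case True
  have tail: "(\<lambda>n. taylor_coeff f (n + 2) * z ^ (n + 2)) sums (f z - (f 0 + deriv f 0 * z))"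
    if "z \<in> unit_disc" for z
  proof -
    have "(\<lambda>n. taylor_coeff f n * z ^ n) sums f z"
      by (rule has_fps_expansion_imp_sums_complex[OF disc_has_fps_expansion[OF True], where r = 1])
        (use True that in auto)
    from sums_split_initial_segment[OF this, of 2] show ?thesis
      using taylor_coeff_0[of f] taylor_coeff_1[of f]
      by (simp add: numeral_2_eq_2 lessThan_Suc add_ac)
  qed
  show ?thesis
  proof
    assume f: "f \<in> normalized_analytic"
    have eq: "f 0 + deriv f 0 * z = z" if "z \<in> unit_disc" for z
    proof -
      have "(\<lambda>n. taylor_coeff f (n + 2) * z ^ (n + 2)) sums (f z - z)"
        using f that by (auto simp: normalized_analytic_def)
      from sums_unique2[OF tail[OF that] this] show ?thesis
        by (simp add: algebra_simps)
    qed
    from eq[of 0] have "f 0 = 0" by simp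
    moreover from this eq[of "1/2"] have "deriv f 0 = 1" by simp
    ultimately show "f holomorphic_on unit_disc \<and> f 0 = 0 \<and> deriv f 0 = 1"
      using True by simp
  next
    assume "f holomorphic_on unit_disc \<and> f 0 = 0 \<and> deriv f 0 = 1"
    then show "f \<in> normalized_analytic"
      using tail by (auto simp: normalized_analytic_def analytic_on_unit_disc_iff)
  qed
qed (simp add: normalized_analytic_def analytic_on_unit_disc_iff)

section \<open>The Schur algorithm on the disc\<close>

definition schur_function :: "(complex \<Rightarrow> complex) \<Rightarrow> bool" where
  "schur_function \<phi> \<longleftrightarrow> \<phi> holomorphic_on unit_disc \<and> (\<forall>z\<in>unit_disc. cmod (\<phi> z) \<le> 1)"

text \<open>The maximum modulus principle.\<close>
lemma schur_function_peak_constant: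
  assumes "schur_function \<phi>" "w \<in> unit_disc" "cmod (\<phi> w) = 1" "z \<in> unit_disc"
  shows "\<phi> z = \<phi> w"
proof -
  have "\<phi> constant_on unit_disc"
    by (rule maximum_modulus_principle[of _ _ unit_disc w])
      (use assms in \<open>auto simp: schur_function_def\<close>)
  then show ?thesis
    using assms(2,4) by (auto simp: constant_on_def)
qed

text \<open>
  The Schwarz lemma in quotient form. It holds for functions into the closed disc because one that
  vanishes at the origin cannot reach modulus one without being constant.
\<close>
lemma schur_function_div_z:
  assumes "schur_function \<psi>" "\<psi> 0 = 0"
  obtains \<eta> where "schur_function \<eta>" "\<And>z. z \<in> unit_disc \<Longrightarrow> \<psi> z = z * \<eta> z"
proof -
  have hol: "\<psi> holomorphic_on ball 0 1"
    using assms by (simp add: schur_function_def)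
  have less: "cmod (\<psi> z) < 1" if "cmod z < 1" for z
  proof (rule ccontr)
    assume "\<not> cmod (\<psi> z) < 1"
    then have "cmod (\<psi> z) = 1"
      using assms(1) that by (auto simp: schur_function_def intro: antisym)
    with schur_function_peak_constant[OF assms(1), of z 0] that assms(2) show False
      by simp
  qed
  obtain \<eta> where \<eta>: "\<eta> holomorphic_on ball 0 1" "\<And>z. cmod z < 1 \<Longrightarrow> \<psi> z = z * \<eta> z"
      "deriv \<psi> 0 = \<eta> 0"
    using Schwarz3[OF hol assms(2)] by metis
  have "cmod (\<eta> z) \<le> 1" if "cmod z < 1" for z
  proof (cases "z = 0")
    case True
    then show ?thesis
      using Schwarz_Lemma(2)[OF hol assms(2) less, of 0] \<eta>(3) by simp
  next
    case False
    then have "cmod z * cmod (\<eta> z) \<le> cmod z * 1"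
      using Schwarz_Lemma(1)[OF hol assms(2) less that] \<eta>(2)[OF that] by (simp add: norm_mult)
    then show ?thesis
      by (rule mult_left_le_imp_le) (use False in simp)
  qed
  then show thesis
    using \<eta> by (intro that) (auto simp: schur_function_def)
qed

text \<open>
  The identity \<open>\<bar>1 - cnj a * w\<bar>\<^sup>2 - \<bar>w - a\<bar>\<^sup>2 = (1 - \<bar>a\<bar>\<^sup>2) * (1 - \<bar>w\<bar>\<^sup>2)\<close> gives
  the bound, which extends to the boundary of the disc: when the denominator vanishes the
  quotient is \<open>0\<close> by convention.
\<close>
lemma moebius_bound:
  assumes "cmod a \<le> 1" "cmod w \<le> 1"
  shows "cmod ((w - a) / (1 - cnj a * w)) \<le> 1"
proof -
  have "(cmod (1 - cnj a * w))\<^sup>2 - (cmod (w - a))\<^sup>2 = (1 - (cmod a)\<^sup>2) * (1 - (cmod w)\<^sup>2)"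
    unfolding cmod_power2 by (simp add: algebra_simps power2_eq_square)
  also have "\<dots> \<ge> 0"
    using assms by (intro mult_nonneg_nonneg) (auto simp: power_le_one)
  finally have "cmod (w - a) \<le> cmod (1 - cnj a * w)"
    by (simp add: power2_le_iff_abs_le)
  then show ?thesis
    by (cases "1 - cnj a * w = 0") (simp_all add: norm_divide divide_le_eq_1)
qed

text \<open>
  A disc automorphism moves \<open>\<phi> 0\<close> to \<open>0\<close>, after which a factor \<open>z\<close> can be split off. The relation
  between \<open>\<phi>\<close> and its successor is stated free of division, so that Taylor coefficients can be read
  off from a product of power series.
\<close>
lemma schur_step:
  assumes "schur_function \<phi>" "cmod (\<phi> 0) < 1"
  obtains \<eta> where "schur_function \<eta>"
    "\<And>z. z \<in> unit_disc \<Longrightarrow> \<phi> z * (1 + cnj (\<phi> 0) * (z * \<eta> z)) = \<phi> 0 + z * \<eta> z"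
proof -
  define a where "a = \<phi> 0"
  define \<psi> where "\<psi> z = (\<phi> z - a) / (1 - cnj a * \<phi> z)" for z
  have nz: "1 - cnj a * \<phi> z \<noteq> 0" if "z \<in> unit_disc" for z
  proof -
    have "cmod (cnj a * \<phi> z) \<le> cmod a * 1"
      unfolding norm_mult using assms that
      by (intro mult_mono) (auto simp: schur_function_def)
    also have "\<dots> < 1" using assms by (simp add: a_def)
    finally show ?thesis by auto
  qed
  have "schur_function \<psi>"
    unfolding schur_function_def \<psi>_def
  proof (intro conjI ballI holomorphic_intros nz moebius_bound)
    show "\<phi> holomorphic_on unit_disc" using assms by (simp add: schur_function_def)
    then show "\<phi> holomorphic_on unit_disc" .
  qed (use assms in \<open>auto simp: schur_function_def a_def\<close>)
  moreover have "\<psi> 0 = 0" by (simp add: \<psi>_def a_def)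
  ultimately obtain \<eta> where \<eta>: "schur_function \<eta>" "\<And>z. z \<in> unit_disc \<Longrightarrow> \<psi> z = z * \<eta> z"
    using schur_function_div_z by metis
  have "\<phi> z * (1 + cnj a * \<psi> z) = a + \<psi> z" if "z \<in> unit_disc" for z
    using nz[OF that] by (simp add: \<psi>_def field_simps)
  then show thesis
    using \<eta> that unfolding a_def by simp
qed

text \<open>
  Here \<open>\<bar>a\<bar> = 1\<close> is allowed: since \<open>\<bar>z * \<eta> z\<bar> < 1\<close>, the denominator has no zero in the open disc,
  and the result is then a constant function.
\<close>
lemma inverse_schur_step:
  assumes "schur_function \<eta>" "cmod a \<le> 1"
  obtains \<phi> where "schur_function \<phi>"
    "\<And>z. z \<in> unit_disc \<Longrightarrow> \<phi> z * (1 + cnj a * (z * \<eta> z)) = a + z * \<eta> z"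
proof -
  define \<phi> where "\<phi> z = (z * \<eta> z - (- a)) / (1 - cnj (- a) * (z * \<eta> z))" for z
  have less: "cmod (z * \<eta> z) < 1" if "z \<in> unit_disc" for z
  proof -
    have "cmod (z * \<eta> z) \<le> cmod z * 1"
      unfolding norm_mult using assms that
      by (intro mult_left_mono) (auto simp: schur_function_def)
    then show ?thesis using that by simp
  qed
  have nz: "1 - cnj (- a) * (z * \<eta> z) \<noteq> 0" if "z \<in> unit_disc" for z
  proof -
    have "cmod (cnj (- a) * (z * \<eta> z)) \<le> 1 * cmod (z * \<eta> z)"
      unfolding norm_mult[of "cnj (- a)"] using assms
      by (intro mult_right_mono) auto
    also have "\<dots> < 1" using less[OF that] by simp
    finally show ?thesis by (metis norm_one eq_iff_diff_eq_0 less_irrefl)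
  qed
  show thesis
  proof
    show "schur_function \<phi>"
      unfolding schur_function_def \<phi>_def
    proof (intro conjI ballI holomorphic_intros nz moebius_bound)
      show "\<eta> holomorphic_on unit_disc" using assms by (simp add: schur_function_def)
      then show "\<eta> holomorphic_on unit_disc" .
    qed (use assms less in \<open>auto intro: less_imp_le\<close>)
    show "\<phi> z * (1 + cnj a * (z * \<eta> z)) = a + z * \<eta> z" if "z \<in> unit_disc" for z
      using nz[OF that] by (simp add: \<phi>_def field_simps)
  qed
qed

lemma schur_step_coefficients:
  assumes "schur_function \<phi>" "schur_function \<eta>"
    and eq: "\<And>z. z \<in> unit_disc \<Longrightarrow> \<phi> z * (1 + b * (z * \<eta> z)) = a + z * \<eta> z"
  shows "taylor_coeff \<phi> 0 = a"
    and "taylor_coeff \<phi> 1 = (1 - a * b) * taylor_coeff \<eta> 0"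
    and "taylor_coeff \<phi> 2 = (1 - a * b) * (taylor_coeff \<eta> 1 - b * (taylor_coeff \<eta> 0)\<^sup>2)"
proof -
  let ?P = "fps_expansion \<phi> 0" and ?C = "fps_expansion \<eta> 0"
  have "\<phi> has_fps_expansion ?P" "\<eta> has_fps_expansion ?C"
    using assms(1,2) by (auto intro!: disc_has_fps_expansion simp: schur_function_def)
  then have "?P * (1 + fps_const b * (fps_X * ?C)) = fps_const a + fps_X * ?C"
    by (intro fps_eq_if_eq_on_disc[OF _ _ eq]) (auto intro!: fps_expansion_intros)
  then have coeff: "fps_nth (?P * (1 + fps_const b * (fps_X * ?C))) n
      = fps_nth (fps_const a + fps_X * ?C) n" for n
    by simp
  have 0: "taylor_coeff \<phi> 0 = a"
    using coeff[of 0] by simp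
  have 1: "taylor_coeff \<phi> 1 + a * b * taylor_coeff \<eta> 0 = taylor_coeff \<eta> 0"
    using coeff[of 1] 0 by (simp add: fps_mult_nth algebra_simps)
  have phi1: "taylor_coeff \<phi> 1 = (1 - a * b) * taylor_coeff \<eta> 0"
    using 1 by (simp add: left_diff_distrib eq_diff_eq)
  have "taylor_coeff \<phi> 2 + b * taylor_coeff \<phi> 1 * taylor_coeff \<eta> 0 + a * b * taylor_coeff \<eta> 1
      = taylor_coeff \<eta> 1"
    using coeff[of 2] 0 by (simp add: fps_mult_nth numeral_2_eq_2 algebra_simps)
  then show "taylor_coeff \<phi> 2 = (1 - a * b) * (taylor_coeff \<eta> 1 - b * (taylor_coeff \<eta> 0)\<^sup>2)"
    unfolding phi1 by (simp add: algebra_simps eq_diff_eq power2_eq_square)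
  show "taylor_coeff \<phi> 0 = a" "taylor_coeff \<phi> 1 = (1 - a * b) * taylor_coeff \<eta> 0"
    by (fact 0 phi1)+
qed

text \<open>
  Coefficient form of one Schur step. If \<open>\<bar>\<phi> 0\<bar> = 1\<close> there is no successor, but \<open>\<phi>\<close> is constant
  and the factor \<open>1 - a * cnj a\<close> vanishes, so the formulas remain true with the successor \<open>0\<close>.
\<close>
lemma schur_reduction:
  assumes "schur_function \<phi>"
  defines "a \<equiv> \<phi> 0"
  obtains \<eta> where "schur_function \<eta>"
    "taylor_coeff \<phi> 1 = (1 - a * cnj a) * taylor_coeff \<eta> 0"
    "taylor_coeff \<phi> 2 = (1 - a * cnj a) * (taylor_coeff \<eta> 1 - cnj a * (taylor_coeff \<eta> 0)\<^sup>2)"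
proof (cases "cmod a < 1")
  case True
  then obtain \<eta> where \<eta>: "schur_function \<eta>"
      "\<And>z. z \<in> unit_disc \<Longrightarrow> \<phi> z * (1 + cnj a * (z * \<eta> z)) = a + z * \<eta> z"
    using schur_step[OF assms(1)] a_def by metis
  then show thesis
    using that schur_step_coefficients[OF assms(1) \<eta>(1), of "cnj a" a] by blast
next
  case False
  then have a: "cmod a = 1"
    using assms(1) by (auto simp: schur_function_def a_def intro: antisym)
  have const: "\<phi> z = a" if "z \<in> unit_disc" for z
    using schur_function_peak_constant[OF assms(1) _ _ that, of 0] a by (simp add: a_def)
  have "\<phi> holomorphic_on unit_disc"
    using assms(1) by (simp add: schur_function_def)
  then have "fps_expansion \<phi> 0 = fps_const a"
    by (rule fps_eq_if_eq_on_disc[OF disc_has_fps_expansion has_fps_expansion_const const])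
  moreover have "a * cnj a = 1"
    using a by (simp add: complex_norm_square[symmetric])
  moreover have "schur_function (\<lambda>_. 0)"
    by (simp add: schur_function_def)
  ultimately show thesis
    using that by simp
qed

text \<open>
  The parameters \<open>x\<close> and \<open>y\<close> are the values at the origin of the first and the second successor
  in the Schur algorithm.
\<close>
lemma schur_coefficients:
  assumes "schur_function \<phi>"
  defines "a \<equiv> \<phi> 0"
  obtains x y where "cmod x \<le> 1" "cmod y \<le> 1"
    "taylor_coeff \<phi> 1 = (1 - a * cnj a) * x"
    "taylor_coeff \<phi> 2 = (1 - a * cnj a) * ((1 - x * cnj x) * y - cnj a * x\<^sup>2)"
proof -
  obtain \<eta> where \<eta>: "schur_function \<eta>"
    "taylor_coeff \<phi> 1 = (1 - a * cnj a) * taylor_coeff \<eta> 0"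
    "taylor_coeff \<phi> 2 = (1 - a * cnj a) * (taylor_coeff \<eta> 1 - cnj a * (taylor_coeff \<eta> 0)\<^sup>2)"
    using schur_reduction[OF assms(1)] unfolding a_def by blast
  obtain \<theta> where \<theta>: "schur_function \<theta>"
    "taylor_coeff \<eta> 1 = (1 - \<eta> 0 * cnj (\<eta> 0)) * taylor_coeff \<theta> 0"
    using schur_reduction[OF \<eta>(1)] by blast
  have "cmod (\<eta> 0) \<le> 1" "cmod (\<theta> 0) \<le> 1"
    using \<eta>(1) \<theta>(1) by (auto simp: schur_function_def)
  then show thesis
    using that[of "\<eta> 0" "\<theta> 0"] \<eta>(2,3) \<theta>(2) unfolding taylor_coeff_0 by metis
qed

text \<open>
  The Schur algorithm run backwards from the constant function \<open>y\<close>, so the description in the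
  preceding lemma is exact.
\<close>
lemma schur_function_exists:
  assumes "cmod a \<le> 1" "cmod x \<le> 1" "cmod y \<le> 1"
  obtains \<phi> where "schur_function \<phi>" "\<phi> 0 = a"
    "taylor_coeff \<phi> 1 = (1 - a * cnj a) * x"
    "taylor_coeff \<phi> 2 = (1 - a * cnj a) * ((1 - x * cnj x) * y - cnj a * x\<^sup>2)"
proof -
  have y: "schur_function (\<lambda>_. y)"
    using assms(3) by (simp add: schur_function_def)
  obtain \<eta> where \<eta>: "schur_function \<eta>"
    "\<And>z. z \<in> unit_disc \<Longrightarrow> \<eta> z * (1 + cnj x * (z * y)) = x + z * y"
    using inverse_schur_step[OF y assms(2)] by blast
  note c\<eta> = schur_step_coefficients[OF \<eta>(1) y, of "cnj x" x, OF \<eta>(2)]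
  obtain \<phi> where \<phi>: "schur_function \<phi>"
    "\<And>z. z \<in> unit_disc \<Longrightarrow> \<phi> z * (1 + cnj a * (z * \<eta> z)) = a + z * \<eta> z"
    using inverse_schur_step[OF \<eta>(1) assms(1)] by blast
  note c\<phi> = schur_step_coefficients[OF \<phi>(1) \<eta>(1), of "cnj a" a, OF \<phi>(2)]
  have "taylor_coeff \<eta> 0 = x" "taylor_coeff \<eta> 1 = (1 - x * cnj x) * y"
    using c\<eta>(1,2) by (simp_all add: taylor_coeff_0[of "\<lambda>_. y"])
  with c\<phi> \<phi>(1) show thesis
    by (intro that) (simp_all add: taylor_coeff_0)
qed

section \<open>Coefficients of the class\<close>

text \<open>
  The function \<open>g z = exp (lam * (z * \<phi> z))\<close> enters through its differential equation
  \<open>g' = lam * (z * \<phi>)' * g\<close>, which determines its coefficients recursively, so that no power series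
  has to be composed. The numerical factors clear all denominators.
\<close>
lemma convex_exp_coefficients:
  fixes lam :: complex
  assumes f: "f holomorphic_on unit_disc" "deriv f 0 = 1"
    and nz: "\<forall>z\<in>unit_disc. deriv f z \<noteq> 0"
    and \<phi>: "\<phi> holomorphic_on unit_disc"
    and eq: "\<forall>z\<in>unit_disc.
      1 + z * deriv (deriv f) z / deriv f z = exp (lam * (z * \<phi> z))"
  defines "c \<equiv> taylor_coeff \<phi>"
  shows "2 * taylor_coeff f 2 = lam * c 0"
    and "12 * taylor_coeff f 3 = lam * (2 * c 1 + 3 * lam * (c 0)\<^sup>2)"
    and "144 * taylor_coeff f 4 = lam * (12 * c 2 + 30 * lam * c 0 * c 1 + 17 * lam\<^sup>2 * c 0 ^ 3)"
proof -
  define g where "g z = exp (lam * (z * \<phi> z))" for z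
  have hol_g: "g holomorphic_on unit_disc"
    unfolding g_def by (intro holomorphic_intros \<phi>)
  let ?F = "fps_expansion f 0" and ?P = "fps_expansion \<phi> 0" and ?G = "fps_expansion g 0"
  have exps: "f has_fps_expansion ?F" "\<phi> has_fps_expansion ?P" "g has_fps_expansion ?G"
    by (intro disc_has_fps_expansion f \<phi> hol_g)+
  have dg: "deriv g z = lam * (\<phi> z + z * deriv \<phi> z) * g z" if "z \<in> unit_disc" for z
  proof -
    have "(\<phi> has_field_derivative deriv \<phi> z) (at z)"
      using \<phi> that by (auto intro: holomorphic_derivI[of _ unit_disc])
    then have "(g has_field_derivative lam * (\<phi> z + z * deriv \<phi> z) * g z) (at z)"
      unfolding g_def by (auto intro!: derivative_eq_intros simp: algebra_simps)
    then show ?thesis by (rule DERIV_imp_deriv)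
  qed
  have "fps_deriv ?G = fps_const lam * (?P + fps_X * fps_deriv ?P) * ?G"
    by (rule fps_eq_if_eq_on_disc[OF _ _ dg]) (auto intro!: fps_expansion_intros exps)
  then have G: "fps_nth (fps_deriv ?G) n = fps_nth (fps_const lam * (?P + fps_X * fps_deriv ?P) * ?G) n" for n
    by simp
  have df: "z * deriv (deriv f) z = (g z - 1) * deriv f z" if "z \<in> unit_disc" for z
    using eq nz that by (simp add: g_def field_simps)
  have "fps_X * fps_deriv (fps_deriv ?F) = (?G - 1) * fps_deriv ?F"
    by (rule fps_eq_if_eq_on_disc[OF _ _ df]) (auto intro!: fps_expansion_intros exps)
  then have F: "fps_nth (fps_X * fps_deriv (fps_deriv ?F)) n = fps_nth ((?G - 1) * fps_deriv ?F) n" for n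
    by simp
  have G0: "fps_nth ?G 0 = 1"
    using taylor_coeff_0[of g] by (simp add: g_def)
  have G1: "fps_nth ?G (Suc 0) = lam * c 0"
    using G[of 0] G0 by (simp add: c_def)
  have G2: "2 * fps_nth ?G 2 = 2 * lam * c 1 + lam\<^sup>2 * (c 0)\<^sup>2"
    using G[of 1] G0 G1
    by (simp add: c_def fps_mult_nth numeral_2_eq_2 algebra_simps)
  have G3: "3 * fps_nth ?G 3 = lam * (3 * c 2 + 2 * c 1 * fps_nth ?G 1 + c 0 * fps_nth ?G 2)"
    using G[of 2] G0
    by (simp add: c_def fps_mult_nth numeral_2_eq_2 numeral_3_eq_3 algebra_simps)
  have F1: "fps_nth ?F (Suc 0) = 1"
    using taylor_coeff_1[of f] f(2) by simp
  have F2: "2 * fps_nth ?F 2 = fps_nth ?G 1"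
    using F[of 1] G0 F1 by (simp add: fps_mult_nth numeral_2_eq_2 algebra_simps)
  have F3: "6 * fps_nth ?F 3 = 2 * fps_nth ?G 1 * fps_nth ?F 2 + fps_nth ?G 2"
    using F[of 2] G0 F1
    by (simp add: fps_mult_nth numeral_2_eq_2 numeral_3_eq_3 algebra_simps)
  have F4: "12 * fps_nth ?F 4
      = 3 * fps_nth ?G 1 * fps_nth ?F 3 + 2 * fps_nth ?G 2 * fps_nth ?F 2 + fps_nth ?G 3"
    using F[of 3] G0 F1
    by (simp add: fps_mult_nth eval_nat_numeral algebra_simps)
  show a2: "2 * taylor_coeff f 2 = lam * c 0"
    using F2 G1 by simp
  have "12 * taylor_coeff f 3 = 2 * (6 * taylor_coeff f 3)"
    by simp
  also have "\<dots> = 2 * fps_nth ?G 1 * (2 * taylor_coeff f 2) + 2 * fps_nth ?G 2"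
    unfolding F3 by (simp only: distrib_left mult_ac)
  finally show a3: "12 * taylor_coeff f 3 = lam * (2 * c 1 + 3 * lam * (c 0)\<^sup>2)"
    unfolding a2 G2 using G1 by (simp add: algebra_simps power2_eq_square)
  have "144 * taylor_coeff f 4 = 12 * (12 * taylor_coeff f 4)"
    by simp
  also have "\<dots> = 3 * fps_nth ?G 1 * (12 * taylor_coeff f 3)
      + 6 * (2 * fps_nth ?G 2) * (2 * taylor_coeff f 2) + 4 * (3 * fps_nth ?G 3)"
    unfolding F4 by (simp add: algebra_simps)
  also have "4 * (3 * fps_nth ?G 3)
      = lam * (12 * c 2 + 8 * c 1 * fps_nth ?G 1 + 2 * c 0 * (2 * fps_nth ?G 2))"
    unfolding G3 by (simp add: algebra_simps)
  finally show "144 * taylor_coeff f 4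
      = lam * (12 * c 2 + 30 * lam * c 0 * c 1 + 17 * lam\<^sup>2 * c 0 ^ 3)"
    unfolding a2 a3 G2 using G1 by (simp add: algebra_simps power2_eq_square power3_eq_cube)
qed

text \<open>
  The equation \<open>z * f'' = (exp (lam * \<omega>) - 1) * f'\<close> says that \<open>f'\<close> has the logarithmic derivative
  \<open>h z = (exp (lam * \<omega> z) - 1) / z\<close>, whose singularity is removable as \<open>\<omega> 0 = 0\<close>. Two primitives
  on the disc therefore yield \<open>f\<close>. Since \<open>f'\<close> is an exponential, it has no zeros.
\<close>
lemma convex_exp_from_schwarz_function:
  fixes lam :: real
  assumes \<omega>: "schwarz_function \<omega>"
  obtains f where "f \<in> convex_exp lam"
    "\<forall>z\<in>unit_disc. 1 + z * deriv (deriv f) z / deriv f z = exp (of_real lam * \<omega> z)"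
proof -
  have hol_\<omega>: "\<omega> holomorphic_on unit_disc" and \<omega>0: "\<omega> 0 = 0"
    using \<omega> by (auto simp: schwarz_function_def analytic_on_unit_disc_iff)
  have "(\<lambda>z. exp (of_real lam * \<omega> z) - 1) holomorphic_on ball 0 1"
    by (intro holomorphic_intros hol_\<omega>)
  then obtain h where h: "h holomorphic_on unit_disc"
      "\<And>z. z \<in> unit_disc \<Longrightarrow> exp (of_real lam * \<omega> z) - 1 = z * h z"
    by (rule Schwarz3) (auto simp: \<omega>0)
  obtain H where H: "\<And>z. z \<in> unit_disc \<Longrightarrow> (H has_field_derivative h z) (at z)"
    using holomorphic_convex_primitive'[OF convex_ball open_ball h(1)]
    by (metis at_within_open open_ball)
  define k where "k z = exp (H z - H 0)" for z
  have dk: "(k has_field_derivative h z * k z) (at z)" if "z \<in> unit_disc" for z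
    unfolding k_def using H[OF that] by (auto intro!: derivative_eq_intros)
  then have "k holomorphic_on unit_disc"
    using holomorphic_on_open open_ball by blast
  then obtain K where K: "\<And>z. z \<in> unit_disc \<Longrightarrow> (K has_field_derivative k z) (at z)"
    using holomorphic_convex_primitive'[OF convex_ball open_ball]
    by (metis at_within_open open_ball)
  define f where "f z = K z - K 0" for z
  have df: "(f has_field_derivative k z) (at z)" if "z \<in> unit_disc" for z
    unfolding f_def using K[OF that] by (auto intro!: derivative_eq_intros)
  then have hol_f: "f holomorphic_on unit_disc"
    using holomorphic_on_open open_ball by blast
  have f1: "deriv f z = k z" if "z \<in> unit_disc" for z
    using df[OF that] by (rule DERIV_imp_deriv)
  have f2: "deriv (deriv f) z = h z * k z" if "z \<in> unit_disc" for z
  proof -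
    have "eventually (\<lambda>w. w \<in> unit_disc) (nhds z)"
      using that by (intro eventually_nhds_in_open) auto
    then have "eventually (\<lambda>w. deriv f w = k w) (nhds z)"
      by eventually_elim (rule f1)
    then have "deriv (deriv f) z = deriv k z"
      by (intro deriv_cong_ev) auto
    with dk[OF that] show ?thesis by (simp add: DERIV_imp_deriv)
  qed
  have k_nz: "k z \<noteq> 0" for z by (simp add: k_def)
  have eq: "1 + z * deriv (deriv f) z / deriv f z = exp (of_real lam * \<omega> z)"
    if "z \<in> unit_disc" for z
    using h(2)[OF that] k_nz[of z] by (simp add: f1[OF that] f2[OF that] algebra_simps)
  have "deriv f 0 = 1" using f1[of 0] by (simp add: k_def)
  then have norm: "f \<in> normalized_analytic"
    using hol_f by (simp add: normalized_analytic_iff f_def)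
  have "(\<lambda>z. 1 + z * deriv (deriv f) z / deriv f z) holomorphic_on unit_disc"
    by (rule holomorphic_transform[of "\<lambda>z. exp (of_real lam * \<omega> z)"])
      (auto intro!: holomorphic_intros hol_\<omega> simp: eq)
  moreover have "(\<lambda>z. exp (of_real lam * z)) holomorphic_on unit_disc"
    by (intro holomorphic_intros)
  ultimately have "f \<in> convex_exp lam"
    using norm \<omega> eq f1 k_nz
    by (auto simp: convex_exp_def subordinate_def analytic_on_unit_disc_iff)
  then show thesis using eq that by blast
qed

text \<open>
  The two coefficient differences in terms of the Schur parameters of \<open>\<phi>\<close>. The terms are grouped so
  that the part independent of \<open>x\<close> and \<open>y\<close> is a nonnegative quantity with a minus sign when
  \<open>0 \<le> p \<le> 1\<close> and \<open>0 \<le> lam \<le> 2\<close>.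
\<close>
lemma coefficient_differences:
  fixes lam p :: real and f \<phi> :: "complex \<Rightarrow> complex" and x y :: complex
  assumes "f holomorphic_on unit_disc" "deriv f 0 = 1"
    and "\<forall>z\<in>unit_disc. deriv f z \<noteq> 0"
    and \<phi>: "schur_function \<phi>" "\<phi> 0 = p"
      "taylor_coeff \<phi> 1 = (1 - of_real p * cnj (of_real p)) * x"
      "taylor_coeff \<phi> 2 = (1 - of_real p * cnj (of_real p))
         * ((1 - x * cnj x) * y - cnj (of_real p) * x\<^sup>2)"
    and "\<forall>z\<in>unit_disc.
      1 + z * deriv (deriv f) z / deriv f z = exp (of_real lam * (z * \<phi> z))"
  shows "12 * (taylor_coeff f 3 - taylor_coeff f 2)
       = lam * (2 * (1 - p\<^sup>2) * x - (6 * p - 3 * lam * p\<^sup>2))"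
    and "144 * (taylor_coeff f 4 - taylor_coeff f 3)
       = lam * (12 * (1 - p\<^sup>2) * ((1 - x * cnj x) * y - p * x\<^sup>2)
           - (24 - 30 * lam * p) * (1 - p\<^sup>2) * x - lam * p\<^sup>2 * (36 - 17 * lam * p))"
proof -
  have hol: "\<phi> holomorphic_on unit_disc"
    using \<phi>(1) by (simp add: schur_function_def)
  note co = convex_exp_coefficients[OF assms(1-3) hol assms(8)]
  have c0: "taylor_coeff \<phi> 0 = p"
    using \<phi>(2) by (simp only: taylor_coeff_0)
  have c1: "taylor_coeff \<phi> 1 = (1 - of_real p * of_real p) * x"
    using \<phi>(3) by simp
  have c2: "taylor_coeff \<phi> 2 = (1 - p * p) * ((1 - x * cnj x) * y - p * x\<^sup>2)"
    using \<phi>(4) by simp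
  have a2: "2 * taylor_coeff f 2 = lam * p"
    using co(1) unfolding c0 by simp
  have a3: "12 * taylor_coeff f 3 = lam * (2 * ((1 - p * p) * x) + 3 * lam * (of_real p)\<^sup>2)"
    using co(2) unfolding c0 c1 by simp
  have a4: "144 * taylor_coeff f 4 = lam * (12 * ((1 - p * p) * ((1 - x * cnj x) * y - p * x\<^sup>2))
      + 30 * lam * p * ((1 - p * p) * x) + 17 * (of_real lam)\<^sup>2 * of_real p ^ 3)"
    using co(3) unfolding c0 c1 c2 by simp
  have "12 * (taylor_coeff f 3 - taylor_coeff f 2)
      = 12 * taylor_coeff f 3 - 6 * (2 * taylor_coeff f 2)"
    by (simp add: algebra_simps)
  then show "12 * (taylor_coeff f 3 - taylor_coeff f 2)
       = lam * (2 * (1 - p\<^sup>2) * x - (6 * p - 3 * lam * p\<^sup>2))"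
    unfolding a2 a3 by (simp add: algebra_simps power2_eq_square)
  have "144 * (taylor_coeff f 4 - taylor_coeff f 3)
      = 144 * taylor_coeff f 4 - 12 * (12 * taylor_coeff f 3)"
    by (simp add: algebra_simps)
  then show "144 * (taylor_coeff f 4 - taylor_coeff f 3)
       = lam * (12 * (1 - p\<^sup>2) * ((1 - x * cnj x) * y - p * x\<^sup>2)
           - (24 - 30 * lam * p) * (1 - p\<^sup>2) * x - lam * p\<^sup>2 * (36 - 17 * lam * p))"
    unfolding a3 a4 by (simp add: algebra_simps power2_eq_square power3_eq_cube)
qed

text \<open>
  This lemma and the next one together describe the set of all pairs of coefficient differences
  exactly. The second derivative at the origin is \<open>lam * p\<close>, which makes \<open>p\<close> the value of \<open>\<phi>\<close> there.
\<close>
lemma convex_exp_fixed_coefficients: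
  fixes lam p :: real
  assumes "lam > 0" "f \<in> convex_exp_fixed lam (lam * p)"
  obtains x y :: complex where "cmod x \<le> 1" "cmod y \<le> 1"
    "12 * (taylor_coeff f 3 - taylor_coeff f 2)
       = lam * (2 * (1 - p\<^sup>2) * x - (6 * p - 3 * lam * p\<^sup>2))"
    "144 * (taylor_coeff f 4 - taylor_coeff f 3)
       = lam * (12 * (1 - p\<^sup>2) * ((1 - x * cnj x) * y - p * x\<^sup>2)
           - (24 - 30 * lam * p) * (1 - p\<^sup>2) * x - lam * p\<^sup>2 * (36 - 17 * lam * p))"
proof -
  have f: "f holomorphic_on unit_disc" "deriv f 0 = 1"
      "\<forall>z\<in>unit_disc. deriv f z \<noteq> 0" "deriv (deriv f) 0 = lam * p"
    using assms(2) by (auto simp: convex_exp_fixed_def convex_exp_def normalized_analytic_iff)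
  obtain \<omega> :: "complex \<Rightarrow> complex" where \<omega>: "schwarz_function \<omega>"
      "\<forall>z\<in>unit_disc. 1 + z * deriv (deriv f) z / deriv f z = exp (of_real lam * \<omega> z)"
    using assms(2) by (auto simp: convex_exp_fixed_def convex_exp_def subordinate_def)
  have "schur_function \<omega>" "\<omega> 0 = 0"
    using \<omega>(1) by (auto simp: schwarz_function_def schur_function_def
        analytic_on_unit_disc_iff intro: less_imp_le)
  then obtain \<phi> :: "complex \<Rightarrow> complex" where \<phi>: "schur_function \<phi>" "\<And>z. z \<in> unit_disc \<Longrightarrow> \<omega> z = z * \<phi> z"
    using schur_function_div_z by blast
  have eq: "\<forall>z\<in>unit_disc.
      1 + z * deriv (deriv f) z / deriv f z = exp (of_real lam * (z * \<phi> z))"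
    using \<omega>(2) \<phi>(2) by simp
  have "\<phi> holomorphic_on unit_disc" using \<phi>(1) by (simp add: schur_function_def)
  from convex_exp_coefficients(1)[OF f(1,2,3) this eq] have p: "\<phi> 0 = p"
    unfolding taylor_coeff_0 taylor_coeff_2 using f(4) assms(1) by simp
  obtain x y :: complex where xy: "cmod x \<le> 1" "cmod y \<le> 1"
    "taylor_coeff \<phi> 1 = (1 - of_real p * cnj (of_real p)) * x"
    "taylor_coeff \<phi> 2 = (1 - of_real p * cnj (of_real p))
       * ((1 - x * cnj x) * y - cnj (of_real p) * x\<^sup>2)"
    using schur_coefficients[OF \<phi>(1)] p by metis
  show thesis
    by (rule that[OF xy(1,2)]) (fact coefficient_differences[OF f(1-3) \<phi>(1) p xy(3,4) eq])+
qed

lemma convex_exp_fixed_exists: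
  fixes lam p :: real and x y :: complex
  assumes "\<bar>p\<bar> \<le> 1" "cmod x \<le> 1" "cmod y \<le> 1"
  obtains f where "f \<in> convex_exp_fixed lam (lam * p)"
    "12 * (taylor_coeff f 3 - taylor_coeff f 2)
       = lam * (2 * (1 - p\<^sup>2) * x - (6 * p - 3 * lam * p\<^sup>2))"
    "144 * (taylor_coeff f 4 - taylor_coeff f 3)
       = lam * (12 * (1 - p\<^sup>2) * ((1 - x * cnj x) * y - p * x\<^sup>2)
           - (24 - 30 * lam * p) * (1 - p\<^sup>2) * x - lam * p\<^sup>2 * (36 - 17 * lam * p))"
proof -
  obtain \<phi> :: "complex \<Rightarrow> complex" where \<phi>: "schur_function \<phi>" "\<phi> 0 = of_real p"
    "taylor_coeff \<phi> 1 = (1 - of_real p * cnj (of_real p)) * x"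
    "taylor_coeff \<phi> 2 = (1 - of_real p * cnj (of_real p))
       * ((1 - x * cnj x) * y - cnj (of_real p) * x\<^sup>2)"
    using schur_function_exists[of "of_real p" x y] assms by (metis norm_of_real)
  have hol: "\<phi> holomorphic_on unit_disc"
    using \<phi>(1) by (simp add: schur_function_def)
  have "cmod (z * \<phi> z) < 1" if "z \<in> unit_disc" for z
  proof -
    have "cmod (z * \<phi> z) \<le> cmod z * 1"
      unfolding norm_mult using \<phi>(1) that
      by (intro mult_left_mono) (auto simp: schur_function_def)
    then show ?thesis using that by simp
  qed
  then have "schwarz_function (\<lambda>z. z * \<phi> z)"
    by (auto simp: schwarz_function_def analytic_on_unit_disc_iff intro!: holomorphic_intros hol)
  then obtain f where f: "f \<in> convex_exp lam"
    "\<forall>z\<in>unit_disc.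
       1 + z * deriv (deriv f) z / deriv f z = exp (of_real lam * (z * \<phi> z))"
    using convex_exp_from_schwarz_function by blast
  then have f': "f holomorphic_on unit_disc" "deriv f 0 = 1"
      "\<forall>z\<in>unit_disc. deriv f z \<noteq> 0"
    by (auto simp: convex_exp_def normalized_analytic_iff)
  from convex_exp_coefficients(1)[OF f' hol f(2)]
  have "deriv (deriv f) 0 = of_real (lam * p)"
    unfolding taylor_coeff_0 taylor_coeff_2 \<phi>(2) by simp
  then have mem: "f \<in> convex_exp_fixed lam (lam * p)"
    using f(1) by (simp add: convex_exp_fixed_def)
  show thesis
    by (rule that[OF mem]) (fact coefficient_differences[OF f' \<phi> f(2)])+
qed

section \<open>Optimisation over the coefficient body\<close>

lemma sharp_upper_boundI:
  assumes "\<And>f. f \<in> S \<Longrightarrow> F f \<le> B" "f0 \<in> S" "F f0 = B"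
  shows "sharp_upper_bound S F B"
  using assms unfolding sharp_upper_bound_def by force

lemma norm_eq_of_scaled:
  fixes z w :: complex and c l :: real
  assumes "of_real c * z = of_real l * w" "c > 0" "l \<ge> 0"
  shows "cmod z = l / c * cmod w"
proof -
  have "c * cmod z = l * cmod w"
    using arg_cong[OF assms(1), of cmod] assms(2,3) by (simp add: norm_mult)
  then show ?thesis
    using assms(2) by (simp add: field_simps)
qed

text \<open>
  The maximum of \<open>\<bar>2 * q * x - s\<bar>\<close> over the disc is \<open>2 * q + s\<close>, attained at \<open>x = -1\<close>, because
  \<open>q\<close> and \<open>s\<close> are nonnegative.
\<close>
lemma sharp_a3_minus_a2:
  fixes lam p :: real
  assumes "0 < lam" "lam \<le> 2" "0 \<le> p" "p \<le> 1"
  shows "sharp_upper_bound (convex_exp_fixed lam (lam * p))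
    (\<lambda>f. cmod (taylor_coeff f 3 - taylor_coeff f 2))
    (1 / 12 * lam * (2 + 6 * p - (3 * lam + 2) * p\<^sup>2))"
proof -
  define q where "q = 1 - p\<^sup>2"
  define s where "s = 6 * p - 3 * lam * p\<^sup>2"
  have q: "q \<ge> 0"
    using assms by (simp add: q_def power_le_one)
  have "lam * p \<le> 2 * 1"
    using assms by (intro mult_mono) auto
  then have "p * (6 - 3 * (lam * p)) \<ge> 0"
    using assms by (intro mult_nonneg_nonneg) auto
  then have s: "s \<ge> 0"
    by (simp add: s_def algebra_simps power2_eq_square)
  have B: "1 / 12 * lam * (2 + 6 * p - (3 * lam + 2) * p\<^sup>2) = lam / 12 * (2 * q + s)"
    by (simp add: q_def s_def algebra_simps)
  obtain f0 where f0: "f0 \<in> convex_exp_fixed lam (lam * p)"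
    "12 * (taylor_coeff f0 3 - taylor_coeff f0 2)
       = lam * (2 * (1 - p\<^sup>2) * (- 1) - (6 * p - 3 * lam * p\<^sup>2))"
    by (rule convex_exp_fixed_exists[of p "- 1" 0 lam]) (use assms in auto)
  have "cmod (taylor_coeff f0 3 - taylor_coeff f0 2) = lam / 12 * cmod (of_real (- (2 * q + s)))"
    by (rule norm_eq_of_scaled) (use f0(2) assms in \<open>auto simp: q_def s_def\<close>)
  also have "cmod (of_real (- (2 * q + s))) = 2 * q + s"
    unfolding norm_of_real using q s by simp
  finally have eq: "cmod (taylor_coeff f0 3 - taylor_coeff f0 2) = lam / 12 * (2 * q + s)" .
  have le: "cmod (taylor_coeff f 3 - taylor_coeff f 2) \<le> lam / 12 * (2 * q + s)"
    if f: "f \<in> convex_exp_fixed lam (lam * p)" for f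
  proof -
    obtain x y :: complex where x: "cmod x \<le> 1"
      "12 * (taylor_coeff f 3 - taylor_coeff f 2)
         = lam * (2 * (1 - p\<^sup>2) * x - (6 * p - 3 * lam * p\<^sup>2))"
      using convex_exp_fixed_coefficients[OF assms(1) f] by metis
    have "cmod (taylor_coeff f 3 - taylor_coeff f 2)
        = lam / 12 * cmod (of_real (2 * q) * x - of_real s)"
      by (rule norm_eq_of_scaled) (use x(2) assms in \<open>auto simp: q_def s_def\<close>)
    also have "cmod (of_real (2 * q) * x - of_real s) \<le> cmod (of_real (2 * q) * x) + cmod (of_real s)"
      by (rule norm_triangle_ineq4)
    also have "\<dots> = 2 * q * cmod x + s"
      unfolding norm_mult norm_of_real using q s by simp
    also have "\<dots> \<le> 2 * q * 1 + s"
      using x(1) q by (intro add_right_mono mult_left_mono) auto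
    finally show ?thesis
      using assms by (simp add: mult_left_mono)
  qed
  show ?thesis
    unfolding B by (rule sharp_upper_boundI[of _ _ _ f0]) (use le f0(1) eq in simp_all)
qed

text \<open>
  Reduction to a real problem. The estimate by the triangle inequality depends only on \<open>r = \<bar>x\<bar>\<close>,
  and the pair \<open>x = r0\<close>, \<open>y = -1\<close> with \<open>r0\<close> real realises the value on the right of the hypothesis
  \<open>max\<close>. So it suffices to exhibit a real \<open>r0\<close> at which the quadratic with \<open>b\<close> dominates the
  quadratic with \<open>\<bar>b\<bar>\<close> on the unit interval.
\<close>
lemma sharp_a4_minus_a3:
  fixes lam p r0 :: real
  assumes "0 < lam" "lam \<le> 2" "0 \<le> p" "p \<le> 1" "\<bar>r0\<bar> \<le> 1"
  defines "b \<equiv> 24 - 30 * lam * p"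
  assumes max: "\<And>r. 0 \<le> r \<Longrightarrow> r \<le> 1 \<Longrightarrow>
    12 - 12 * (1 - p) * r\<^sup>2 + \<bar>b\<bar> * r \<le> 12 - 12 * (1 - p) * r0\<^sup>2 + b * r0"
  shows "sharp_upper_bound (convex_exp_fixed lam (lam * p))
    (\<lambda>f. cmod (taylor_coeff f 4 - taylor_coeff f 3))
    (1 / 144 * lam * ((1 - p\<^sup>2) * (12 - 12 * (1 - p) * r0\<^sup>2 + b * r0)
       + lam * p\<^sup>2 * (36 - 17 * lam * p)))"
proof -
  define q where "q = 1 - p\<^sup>2"
  define d where "d = lam * p\<^sup>2 * (36 - 17 * lam * p)"
  define m where "m = 12 - 12 * (1 - p) * r0\<^sup>2 + b * r0"
  have q: "q \<ge> 0"
    using assms by (simp add: q_def power_le_one)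
  have "lam * p \<le> 2 * 1"
    using assms by (intro mult_mono) auto
  then have d: "d \<ge> 0"
    using assms unfolding d_def by (intro mult_nonneg_nonneg) auto
  have m: "m \<ge> 0"
    using max[of 0] by (simp add: m_def)
  have B: "1 / 144 * lam * ((1 - p\<^sup>2) * (12 - 12 * (1 - p) * r0\<^sup>2 + b * r0)
       + lam * p\<^sup>2 * (36 - 17 * lam * p)) = lam / 144 * (q * m + d)"
    by (simp add: q_def d_def m_def)
  obtain f0 where f0: "f0 \<in> convex_exp_fixed lam (lam * p)"
    "144 * (taylor_coeff f0 4 - taylor_coeff f0 3)
       = lam * (12 * (1 - p\<^sup>2) * ((1 - of_real r0 * cnj (of_real r0)) * (- 1) - p * (of_real r0)\<^sup>2)
           - (24 - 30 * lam * p) * (1 - p\<^sup>2) * of_real r0 - lam * p\<^sup>2 * (36 - 17 * lam * p))"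
    by (rule convex_exp_fixed_exists[of p "of_real r0" "- 1" lam]) (use assms in auto)
  have "cmod (taylor_coeff f0 4 - taylor_coeff f0 3) = lam / 144 * cmod (of_real (- (q * m + d)))"
  proof (rule norm_eq_of_scaled)
    have "- (q * m + d) = 12 * (1 - p\<^sup>2) * ((1 - r0 * r0) * (- 1) - p * r0\<^sup>2)
           - (24 - 30 * lam * p) * (1 - p\<^sup>2) * r0 - lam * p\<^sup>2 * (36 - 17 * lam * p)"
      by (simp add: q_def m_def d_def b_def algebra_simps power2_eq_square)
    then show "of_real 144 * (taylor_coeff f0 4 - taylor_coeff f0 3)
        = of_real lam * of_real (- (q * m + d))"
      using f0(2) by simp
  qed (use assms in auto)
  also have "cmod (of_real (- (q * m + d))) = q * m + d"
    unfolding norm_of_real using mult_nonneg_nonneg[OF q m] d by simp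
  finally have eq: "cmod (taylor_coeff f0 4 - taylor_coeff f0 3) = lam / 144 * (q * m + d)" .
  have le: "cmod (taylor_coeff f 4 - taylor_coeff f 3) \<le> lam / 144 * (q * m + d)"
    if f: "f \<in> convex_exp_fixed lam (lam * p)" for f
  proof -
    obtain x y :: complex where x: "cmod x \<le> 1" and y: "cmod y \<le> 1" and
      "144 * (taylor_coeff f 4 - taylor_coeff f 3)
         = lam * (12 * (1 - p\<^sup>2) * ((1 - x * cnj x) * y - p * x\<^sup>2)
           - (24 - 30 * lam * p) * (1 - p\<^sup>2) * x - lam * p\<^sup>2 * (36 - 17 * lam * p))"
      using convex_exp_fixed_coefficients[OF assms(1) f] by metis
    moreover define r where "r = cmod x"
    ultimately have "of_real 144 * (taylor_coeff f 4 - taylor_coeff f 3)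
        = of_real lam * (of_real q * (of_real (12 * (1 - r\<^sup>2)) * y - of_real (12 * p) * x\<^sup>2
            - of_real b * x) - of_real d)"
      unfolding q_def d_def b_def r_def complex_norm_square[symmetric]
      by (simp add: complex_norm_square algebra_simps)
    then have "cmod (taylor_coeff f 4 - taylor_coeff f 3)
        = lam / 144 * cmod (of_real q * (of_real (12 * (1 - r\<^sup>2)) * y - of_real (12 * p) * x\<^sup>2
            - of_real b * x) - of_real d)"
      by (rule norm_eq_of_scaled) (use assms in auto)
    also have "cmod (of_real q * (of_real (12 * (1 - r\<^sup>2)) * y - of_real (12 * p) * x\<^sup>2
            - of_real b * x) - of_real d)
        \<le> q * (12 * (1 - r\<^sup>2) + 12 * p * r\<^sup>2 + \<bar>b\<bar> * r) + d"
    proof -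
      have r: "0 \<le> r" "r\<^sup>2 \<le> 1"
        using x by (auto simp: r_def power_le_one)
      have "cmod (of_real (12 * (1 - r\<^sup>2)) * y) \<le> 12 * (1 - r\<^sup>2) * 1"
        unfolding norm_mult norm_of_real using y r by (intro mult_mono) auto
      moreover have "cmod (of_real (12 * p) * x\<^sup>2) = 12 * p * r\<^sup>2"
        unfolding norm_mult norm_of_real norm_power r_def using assms by simp
      moreover have "cmod (of_real b * x) = \<bar>b\<bar> * r"
        unfolding norm_mult norm_of_real r_def by simp
      ultimately have "cmod (of_real (12 * (1 - r\<^sup>2)) * y - of_real (12 * p) * x\<^sup>2 - of_real b * x)
          \<le> 12 * (1 - r\<^sup>2) + 12 * p * r\<^sup>2 + \<bar>b\<bar> * r"
        using norm_triangle_ineq4[of "of_real (12 * (1 - r\<^sup>2)) * y - of_real (12 * p) * x\<^sup>2"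
            "of_real b * x"]
          norm_triangle_ineq4[of "of_real (12 * (1 - r\<^sup>2)) * y" "of_real (12 * p) * x\<^sup>2"]
        by linarith
      then have "cmod (of_real q * (of_real (12 * (1 - r\<^sup>2)) * y - of_real (12 * p) * x\<^sup>2
            - of_real b * x)) \<le> q * (12 * (1 - r\<^sup>2) + 12 * p * r\<^sup>2 + \<bar>b\<bar> * r)"
        unfolding norm_mult[of "of_real q"] norm_of_real using q by (simp add: mult_left_mono)
      moreover have "cmod (of_real d) = d"
        using d by simp
      ultimately show ?thesis
        using norm_triangle_ineq4[of "of_real q * (of_real (12 * (1 - r\<^sup>2)) * y
            - of_real (12 * p) * x\<^sup>2 - of_real b * x)" "of_real d"]
        by linarith
    qed
    also have "12 * (1 - r\<^sup>2) + 12 * p * r\<^sup>2 + \<bar>b\<bar> * r = 12 - 12 * (1 - p) * r\<^sup>2 + \<bar>b\<bar> * r"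
      by (simp add: algebra_simps)
    also have "\<dots> \<le> m"
      using max[of r] x by (simp add: r_def m_def)
    finally show ?thesis
      using q assms by (simp add: mult_left_mono)
  qed
  show ?thesis
    unfolding B by (rule sharp_upper_boundI[of _ _ _ f0]) (use le f0(1) eq in simp_all)
qed

text \<open>
  For \<open>lam < 4 / 5\<close> one has \<open>b \<ge> 24 * (1 - p)\<close>, so the vertex is not to the left of \<open>1\<close>, the
  quadratic increases on the unit interval, and its maximum is at \<open>r0 = 1\<close>.
\<close>
lemma sharp_a4_minus_a3_Theta1:
  fixes lam p :: real
  assumes "0 < lam" "lam < 4 / 5" "0 \<le> p" "p \<le> 1"
  shows "sharp_upper_bound (convex_exp_fixed lam (lam * p))
    (\<lambda>f. cmod (taylor_coeff f 4 - taylor_coeff f 3)) (Theta1 lam p)"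
proof -
  define b where "b = 24 - 30 * lam * p"
  have "lam * p \<le> 4 / 5 * p"
    using assms by (intro mult_right_mono) auto
  then have b: "b \<ge> 24 * (1 - p)"
    by (simp add: b_def)
  have max: "12 - 12 * (1 - p) * r\<^sup>2 + \<bar>b\<bar> * r \<le> 12 - 12 * (1 - p) * 1\<^sup>2 + b * 1"
    if "0 \<le> r" "r \<le> 1" for r
  proof -
    have "12 * (1 - p) * (1 + r) \<le> 12 * (1 - p) * 2"
      using that assms by (intro mult_left_mono) auto
    \<comment> \<open>This product is the value of the quadratic at \<open>1\<close> minus its value at \<open>r\<close>.\<close>
    then have "(1 - r) * (b - 12 * (1 - p) * (1 + r)) \<ge> 0"
      using that b by (intro mult_nonneg_nonneg) auto
    moreover have "\<bar>b\<bar> = b"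
      using b assms by simp
    ultimately show ?thesis
      by (simp add: algebra_simps power2_eq_square)
  qed
  have "sharp_upper_bound (convex_exp_fixed lam (lam * p))
    (\<lambda>f. cmod (taylor_coeff f 4 - taylor_coeff f 3))
    (1 / 144 * lam * ((1 - p\<^sup>2) * (12 - 12 * (1 - p) * 1\<^sup>2 + b * 1)
       + lam * p\<^sup>2 * (36 - 17 * lam * p)))"
    unfolding b_def
    by (rule sharp_a4_minus_a3) (use assms max in \<open>auto simp: b_def\<close>)
  also have "1 / 144 * lam * ((1 - p\<^sup>2) * (12 - 12 * (1 - p) * 1\<^sup>2 + b * 1)
       + lam * p\<^sup>2 * (36 - 17 * lam * p)) = Theta1 lam p"
    by (simp add: Theta1_def b_def algebra_simps power2_eq_square power3_eq_cube)
  finally show ?thesis .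
qed

text \<open>
  For \<open>lam \<ge> 4 / 5\<close> the condition \<open>p \<le> 8 / (4 + 5 * lam)\<close> means \<open>\<bar>b\<bar> \<le> 24 * (1 - p)\<close>: the
  vertex lies in the unit interval and the maximum is taken there. Beyond the threshold \<open>b\<close> is
  negative and the quadratic with \<open>\<bar>b\<bar>\<close> increases, so the maximum is at \<open>r0 = -1\<close>.
\<close>
lemma sharp_a4_minus_a3_Theta2:
  fixes lam p :: real
  assumes "4 / 5 \<le> lam" "lam \<le> 2" "0 \<le> p" "p \<le> 1"
  shows "sharp_upper_bound (convex_exp_fixed lam (lam * p))
    (\<lambda>f. cmod (taylor_coeff f 4 - taylor_coeff f 3)) (Theta2 lam p)"
proof -
  define b where "b = 24 - 30 * lam * p"
  show ?thesis
  proof (cases "p \<le> 8 / (4 + 5 * lam)")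
    case True
    then have p: "p * (4 + 5 * lam) \<le> 8"
      using assms by (simp add: field_simps)
    have "4 / 5 * p \<le> lam * p"
      using assms by (intro mult_right_mono) auto
    then have b: "\<bar>b\<bar> \<le> 24 * (1 - p)"
      using p by (simp add: b_def abs_le_iff algebra_simps)
    \<comment> \<open>If \<open>p = 1\<close>, then \<open>b = 0\<close> and the convention \<open>0 / 0 = 0\<close> gives an admissible \<open>r0\<close>.\<close>
    define r0 where "r0 = b / (24 * (1 - p))"
    have r0: "b = 24 * (1 - p) * r0" "\<bar>r0\<bar> \<le> 1"
      using b assms by (cases "p = 1"; simp add: r0_def divide_le_eq_1)+
    have max: "12 - 12 * (1 - p) * r\<^sup>2 + \<bar>b\<bar> * r \<le> 12 - 12 * (1 - p) * r0\<^sup>2 + b * r0"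
      if "0 \<le> r" for r
    proof -
      \<comment> \<open>Completing the square; using \<open>b = 24 * (1 - p) * r0\<close> avoids dividing by \<open>1 - p\<close>.\<close>
      have "12 * (1 - p) * (r - \<bar>r0\<bar>)\<^sup>2 \<ge> 0"
        using assms by simp
      then have "12 - 12 * (1 - p) * r\<^sup>2 + 24 * (1 - p) * \<bar>r0\<bar> * r
          \<le> 12 - 12 * (1 - p) * r0\<^sup>2 + 24 * (1 - p) * r0 * r0"
        by (simp add: algebra_simps power2_eq_square)
      moreover have "\<bar>b\<bar> * r = 24 * (1 - p) * \<bar>r0\<bar> * r"
        unfolding r0(1) using assms by (simp add: abs_mult)
      moreover have "b * r0 = 24 * (1 - p) * r0 * r0"
        by (subst r0(1)) simp
      ultimately show ?thesis
        by linarith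
    qed
    have "sharp_upper_bound (convex_exp_fixed lam (lam * p))
      (\<lambda>f. cmod (taylor_coeff f 4 - taylor_coeff f 3))
      (1 / 144 * lam * ((1 - p\<^sup>2) * (12 - 12 * (1 - p) * r0\<^sup>2 + b * r0)
         + lam * p\<^sup>2 * (36 - 17 * lam * p)))"
      unfolding b_def
      by (rule sharp_a4_minus_a3) (use assms max r0(2) in \<open>auto simp: b_def\<close>)
    also have "(1 - p\<^sup>2) * (12 - 12 * (1 - p) * r0\<^sup>2 + b * r0) = 12 * (1 - p\<^sup>2) + (1 + p) * b\<^sup>2 / 48"
      unfolding r0(1) by (simp add: field_simps power2_eq_square)
    also have "1 / 144 * lam * (12 * (1 - p\<^sup>2) + (1 + p) * b\<^sup>2 / 48 + lam * p\<^sup>2 * (36 - 17 * lam * p))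
        = Theta2 lam p"
      using True by (simp add: Theta2_def b_def field_simps power2_eq_square power3_eq_cube)
    finally show ?thesis .
  next
    case False
    then have p: "p * (4 + 5 * lam) > 8"
      using assms by (simp add: field_simps)
    then have b: "- b \<ge> 24 * (1 - p)"
      by (simp add: b_def algebra_simps)
    have max: "12 - 12 * (1 - p) * r\<^sup>2 + \<bar>b\<bar> * r \<le> 12 - 12 * (1 - p) * (- 1)\<^sup>2 + b * (- 1)"
      if "0 \<le> r" "r \<le> 1" for r
    proof -
      have "12 * (1 - p) * (1 + r) \<le> 12 * (1 - p) * 2"
        using that assms by (intro mult_left_mono) auto
      then have "(1 - r) * (- b - 12 * (1 - p) * (1 + r)) \<ge> 0"
        using that b by (intro mult_nonneg_nonneg) auto
      moreover have "\<bar>b\<bar> = - b"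
        using b assms by simp
      ultimately show ?thesis
        by (simp add: algebra_simps power2_eq_square)
    qed
    have "sharp_upper_bound (convex_exp_fixed lam (lam * p))
      (\<lambda>f. cmod (taylor_coeff f 4 - taylor_coeff f 3))
      (1 / 144 * lam * ((1 - p\<^sup>2) * (12 - 12 * (1 - p) * (- 1)\<^sup>2 + b * (- 1))
         + lam * p\<^sup>2 * (36 - 17 * lam * p)))"
      unfolding b_def
      by (rule sharp_a4_minus_a3) (use assms max in \<open>auto simp: b_def\<close>)
    also have "1 / 144 * lam * ((1 - p\<^sup>2) * (12 - 12 * (1 - p) * (- 1)\<^sup>2 + b * (- 1))
         + lam * p\<^sup>2 * (36 - 17 * lam * p)) = Theta2 lam p"
      using False by (simp add: Theta2_def b_def algebra_simps power2_eq_square power3_eq_cube)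
    finally show ?thesis .
  qed
qed

theorem theorem4:
  fixes lam p_hat p :: real
  assumes "0 < lam" and "lam \<le> pi / 2"
    and "0 \<le> p_hat" and "p_hat \<le> lam"
    and "p = p_hat / lam"
  shows "sharp_upper_bound (convex_exp_fixed lam p_hat)
           (\<lambda>f. cmod (taylor_coeff f 3 - taylor_coeff f 2))
           (1 / 12 * lam * (2 + 6 * p - (3 * lam + 2) * p^2)) \<and>
         sharp_upper_bound (convex_exp_fixed lam p_hat)
           (\<lambda>f. cmod (taylor_coeff f 4 - taylor_coeff f 3))
           (if lam < 4 / 5 then Theta1 lam p else Theta2 lam p)"
proof -
  have lam: "lam \<le> 2"
    using assms(2) pi_less_4 by simp
  have p: "0 \<le> p" "p \<le> 1" and p_hat: "p_hat = lam * p"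
    using assms by simp_all
  show ?thesis
    unfolding p_hat
    using sharp_a3_minus_a2[OF assms(1) lam p] sharp_a4_minus_a3_Theta1[OF assms(1) _ p]
      sharp_a4_minus_a3_Theta2[OF _ lam p]
    by (simp only: not_less split: if_split) blast
qed

end
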